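(* $\mathrm{SAT}(\mathrm{LRV}_{vec}(\mathsf{X},\mathsf{U}))$ is undecidable.
   Context: Logic LRV: fix a countably infinite set $\mathrm{VAR}$ of variables. Formulas are $\varphi ::= \mathtt{x} \approx \mathsf{X}^i \mathtt{y} \mid \mathtt{x} \approx \langle \varphi ? \rangle \mathtt{y} \mid \mathtt{x} \not\approx \langle \varphi ? \rangle \mathtt{y} \mid \varphi \wedge \varphi \mid \neg \varphi \mid \mathsf{X}\varphi \mid \varphi \mathsf{U} \varphi \mid \mathsf{X}^{-1}\varphi \mid \varphi \mathsf{S} \varphi$ with $\mathtt{x},\mathtt{y}\in\mathrm{VAR}$, $i\in\mathbb{N}$. A model is a finite non-empty sequence $\sigma$ of valuations $\mathrm{VAR}\to\mathbb{N}$. For $0\le i<|\sigma|$: $\sigma,i\models \mathtt{x}\approx\mathsf{X}^j\mathtt{y}$ iff $i+j<|\sigma|$ and $\sigma(i)(\mathtt{x})=\sigma(i+j)(\mathtt{y})$; $\sigma,i\models \mathtt{x}\approx\langle\varphi?\rangle\mathtt{y}$ iff there is $i<j<|\sigma|$ with $\sigma(i)(\mathtt{x})=\sigma(j)(\mathtt{y})$ and $\sigma,j\models\varphi$; $\not\approx$ similarly with $\neq$; Boolean connectives as usual; $\sigma,i\models\mathsf{X}\varphi$ iff $i+1<|\sigma|$ and $\sigma,i+1\models\varphi$; $\sigma,i\models\varphi\mathsf{U}\psi$ iff there is $i\le j<|\sigma|$ with $\sigma,j\models\psi$ and $\sigma,l\models\varphi$ for $i\le l<j$. $\mathrm{LRV}_{vec}$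 extends LRV with atomic formulas $(\mathtt{x}_1,\dots,\mathtt{x}_k)\approx\langle\varphi?\rangle(\mathtt{y}_1,\dots,\mathtt{y}_k)$, with $\sigma,i\models(\mathtt{x}_1,\dots,\mathtt{x}_k)\approx\langle\varphi?\rangle(\mathtt{y}_1,\dots,\mathtt{y}_k)$ iff there is $i<j<|\sigma|$ with $\sigma,j\models\varphi$ and $\sigma(i)(\mathtt{x}_l)=\sigma(j)(\mathtt{y}_l)$ for all $l\in[1,k]$. $\mathrm{LRV}_{vec}(\mathsf{X},\mathsf{U})$ is its fragment whose only temporal operators are $\mathsf{X}$ and $\mathsf{U}$. $\mathrm{SAT}$: given a formula $\varphi$, decide whether $\sigma,0\models\varphi$ for some model $\sigma$. *)

theory Defs
  imports Main "HOL-Library.Nat_Bijection"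
begin

type_synonym var = nat

type_synonym valuation = "var \<Rightarrow> nat"

text \<open>
  Raw syntax of LRV extended by the vectorial atoms and with all temporal operators:
  \<open>EqX x i y\<close> is \<open>x \<approx> X\<^sup>i y\<close>, \<open>EqTest x \<phi> y\<close> is \<open>x \<approx> \<langle>\<phi>?\<rangle> y\<close>, \<open>NeqTest x \<phi> y\<close> is
  \<open>x \<notapprox> \<langle>\<phi>?\<rangle> y\<close>, and \<open>VecEqTest xs \<phi> ys\<close> is the vectorial version of \<open>EqTest\<close>.
  That the two vectors have the same length \<open>k \<ge> 1\<close> is imposed by \<open>LRV_vec\<close> below.
\<close>

datatype form =
    EqX var nat var
  | EqTest var form var
  | NeqTest var form var
  | VecEqTest "var list" form "var list"
  | And form form
  | Neg form
  | Next form
  | Until form form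
  | Prev form
  | Since form form

primrec sat :: "valuation list \<Rightarrow> nat \<Rightarrow> form \<Rightarrow> bool" where
  "sat \<sigma> i (EqX x j y) \<longleftrightarrow> i + j < length \<sigma> \<and> (\<sigma> ! i) x = (\<sigma> ! (i + j)) y"
| "sat \<sigma> i (EqTest x \<phi> y) \<longleftrightarrow>
     (\<exists>j. i < j \<and> j < length \<sigma> \<and> (\<sigma> ! i) x = (\<sigma> ! j) y \<and> sat \<sigma> j \<phi>)"
| "sat \<sigma> i (NeqTest x \<phi> y) \<longleftrightarrow>
     (\<exists>j. i < j \<and> j < length \<sigma> \<and> (\<sigma> ! i) x \<noteq> (\<sigma> ! j) y \<and> sat \<sigma> j \<phi>)"
| "sat \<sigma> i (VecEqTest xs \<phi> ys) \<longleftrightarrow>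
     (\<exists>j. i < j \<and> j < length \<sigma> \<and> map (\<sigma> ! i) xs = map (\<sigma> ! j) ys \<and> sat \<sigma> j \<phi>)"
| "sat \<sigma> i (And \<phi> \<psi>) \<longleftrightarrow> sat \<sigma> i \<phi> \<and> sat \<sigma> i \<psi>"
| "sat \<sigma> i (Neg \<phi>) \<longleftrightarrow> \<not> sat \<sigma> i \<phi>"
| "sat \<sigma> i (Next \<phi>) \<longleftrightarrow> i + 1 < length \<sigma> \<and> sat \<sigma> (i + 1) \<phi>"
| "sat \<sigma> i (Until \<phi> \<psi>) \<longleftrightarrow>
     (\<exists>j. i \<le> j \<and> j < length \<sigma> \<and> sat \<sigma> j \<psi> \<and> (\<forall>l. i \<le> l \<and> l < j \<longrightarrow> sat \<sigma> l \<phi>))"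
| "sat \<sigma> i (Prev \<phi>) \<longleftrightarrow> 1 \<le> i \<and> sat \<sigma> (i - 1) \<phi>"
| "sat \<sigma> i (Since \<phi> \<psi>) \<longleftrightarrow>
     (\<exists>j. j \<le> i \<and> sat \<sigma> j \<psi> \<and> (\<forall>l. j < l \<and> l \<le> i \<longrightarrow> sat \<sigma> l \<phi>))"

definition satisfiable :: "form \<Rightarrow> bool" where
  "satisfiable \<phi> \<longleftrightarrow> (\<exists>\<sigma>. \<sigma> \<noteq> [] \<and> sat \<sigma> 0 \<phi>)"

primrec vec_wf :: "form \<Rightarrow> bool" where
  "vec_wf (EqX x j y) \<longleftrightarrow> True"
| "vec_wf (EqTest x \<phi> y) \<longleftrightarrow> vec_wf \<phi>"
| "vec_wf (NeqTest x \<phi> y) \<longleftrightarrow> vec_wf \<phi>"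
| "vec_wf (VecEqTest xs \<phi> ys) \<longleftrightarrow> length xs = length ys \<and> xs \<noteq> [] \<and> vec_wf \<phi>"
| "vec_wf (And \<phi> \<psi>) \<longleftrightarrow> vec_wf \<phi> \<and> vec_wf \<psi>"
| "vec_wf (Neg \<phi>) \<longleftrightarrow> vec_wf \<phi>"
| "vec_wf (Next \<phi>) \<longleftrightarrow> vec_wf \<phi>"
| "vec_wf (Until \<phi> \<psi>) \<longleftrightarrow> vec_wf \<phi> \<and> vec_wf \<psi>"
| "vec_wf (Prev \<phi>) \<longleftrightarrow> vec_wf \<phi>"
| "vec_wf (Since \<phi> \<psi>) \<longleftrightarrow> vec_wf \<phi> \<and> vec_wf \<psi>"

primrec past_free :: "form \<Rightarrow> bool" where
  "past_free (EqX x j y) \<longleftrightarrow> True"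
| "past_free (EqTest x \<phi> y) \<longleftrightarrow> past_free \<phi>"
| "past_free (NeqTest x \<phi> y) \<longleftrightarrow> past_free \<phi>"
| "past_free (VecEqTest xs \<phi> ys) \<longleftrightarrow> past_free \<phi>"
| "past_free (And \<phi> \<psi>) \<longleftrightarrow> past_free \<phi> \<and> past_free \<psi>"
| "past_free (Neg \<phi>) \<longleftrightarrow> past_free \<phi>"
| "past_free (Next \<phi>) \<longleftrightarrow> past_free \<phi>"
| "past_free (Until \<phi> \<psi>) \<longleftrightarrow> past_free \<phi> \<and> past_free \<psi>"
| "past_free (Prev \<phi>) \<longleftrightarrow> False"
| "past_free (Since \<phi> \<psi>) \<longleftrightarrow> False"

definition LRV_vec :: "form set" where
  "LRV_vec = {\<phi>. vec_wf \<phi>}"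

definition LRV_vec_XU :: "form set" where
  "LRV_vec_XU = {\<phi> \<in> LRV_vec. past_free \<phi>}"

text \<open>
  Definitions of partial recursive functions (Kleene). Arities are left implicit: \<open>Zero\<close> denotes
  the constant zero function of every arity, and the projections, which count from 0, are
  defined on all sufficiently long argument lists.
\<close>

datatype recf =
    Zero
  | Succ
  | Proj nat
  | Comp recf "recf list"
  | PrimRec recf recf
  | Mu recf

text \<open>
  \<open>rec_eval r xs y\<close>: the partial function denoted by \<open>r\<close> is defined on \<open>xs\<close>, with value \<open>y\<close>.
  The recursion and search variable is the first argument. As usual, \<open>Mu\<close> requires the function
  to be defined at all values below the one found.
\<close>

inductive rec_eval :: "recf \<Rightarrow> nat list \<Rightarrow> nat \<Rightarrow> bool" where
  Zero: "rec_eval Zero xs 0"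
| Succ: "rec_eval Succ [x] (Suc x)"
| Proj: "i < length xs \<Longrightarrow> rec_eval (Proj i) xs (xs ! i)"
| Comp: "list_all2 (\<lambda>g y. rec_eval g xs y) gs ys \<Longrightarrow> rec_eval f ys z
    \<Longrightarrow> rec_eval (Comp f gs) xs z"
| PrimRec_0: "rec_eval f xs y \<Longrightarrow> rec_eval (PrimRec f g) (0 # xs) y"
| PrimRec_Suc: "rec_eval (PrimRec f g) (n # xs) y \<Longrightarrow> rec_eval g (n # y # xs) z
    \<Longrightarrow> rec_eval (PrimRec f g) (Suc n # xs) z"
| Mu: "rec_eval f (n # xs) 0 \<Longrightarrow> (\<And>m. m < n \<Longrightarrow> \<exists>k. rec_eval f (m # xs) (Suc k))
    \<Longrightarrow> rec_eval (Mu f) xs n"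

text \<open>
  The decision problem ``given \<open>x \<in> I\<close>, decide whether \<open>P x\<close>'', where instances are presented
  by their codes \<open>enc x\<close>. Nothing is required of the algorithm on numbers that do not encode
  an instance.
\<close>

definition decidable :: "('a \<Rightarrow> nat) \<Rightarrow> 'a set \<Rightarrow> ('a \<Rightarrow> bool) \<Rightarrow> bool" where
  "decidable enc I P \<longleftrightarrow> (\<exists>r. \<forall>x\<in>I. rec_eval r [enc x] (if P x then 1 else 0))"

primrec form_encode :: "form \<Rightarrow> nat" where
  "form_encode (EqX x j y) = list_encode [0, x, j, y]"
| "form_encode (EqTest x \<phi> y) = list_encode [1, x, form_encode \<phi>, y]"
| "form_encode (NeqTest x \<phi> y) = list_encode [2, x, form_encode \<phi>, y]"
| "form_encode (VecEqTest xs \<phi> ys) =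
     list_encode [3, list_encode xs, form_encode \<phi>, list_encode ys]"
| "form_encode (And \<phi> \<psi>) = list_encode [4, form_encode \<phi>, form_encode \<psi>]"
| "form_encode (Neg \<phi>) = list_encode [5, form_encode \<phi>]"
| "form_encode (Next \<phi>) = list_encode [6, form_encode \<phi>]"
| "form_encode (Until \<phi> \<psi>) = list_encode [7, form_encode \<phi>, form_encode \<psi>]"
| "form_encode (Prev \<phi>) = list_encode [8, form_encode \<phi>]"
| "form_encode (Since \<phi> \<psi>) = list_encode [9, form_encode \<phi>, form_encode \<psi>]"

lemma form_encode_inject: "form_encode \<phi> = form_encode \<psi> \<Longrightarrow> \<phi> = \<psi>"
proof (induction \<phi> arbitrary: \<psi>)
qed (case_tac \<psi>; simp del: list_encode.simps add: list_encode_eq)+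

lemma inj_form_encode: "inj form_encode"
  by (rule injI) (rule form_encode_inject)

inductive_cases rec_eval_ZeroE: "rec_eval Zero xs y"
inductive_cases rec_eval_SuccE: "rec_eval Succ xs y"
inductive_cases rec_eval_ProjE: "rec_eval (Proj i) xs y"
inductive_cases rec_eval_CompE: "rec_eval (Comp f gs) xs z"
inductive_cases rec_eval_PrimRec_0E: "rec_eval (PrimRec f g) (0 # xs) y"
inductive_cases rec_eval_PrimRec_SucE: "rec_eval (PrimRec f g) (Suc n # xs) y"
inductive_cases rec_eval_MuE: "rec_eval (Mu f) xs n"

lemma rec_eval_deterministic: "rec_eval r xs y \<Longrightarrow> rec_eval r xs z \<Longrightarrow> y = z"
proof (induction arbitrary: z rule: rec_eval.induct)
  case (Zero xs)
  then show ?case by (blast elim: rec_eval_ZeroE)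
next
  case (Succ x)
  then show ?case by (blast elim: rec_eval_SuccE)
next
  case (Proj i xs)
  from Proj(2) show ?case by (rule rec_eval_ProjE) simp
next
  case (Comp xs gs ys f u)
  from Comp.prems obtain ys' where
    ys': "list_all2 (\<lambda>g y. rec_eval g xs y) gs ys'" "rec_eval f ys' z"
    by (rule rec_eval_CompE)
  have "ys = ys'"
  proof (rule nth_equalityI)
    show len: "length ys = length ys'"
      using Comp.IH(1) ys'(1) by (simp add: list_all2_conv_all_nth)
    show "ys ! i = ys' ! i" if "i < length ys" for i
      using Comp.IH(1) ys'(1) that unfolding list_all2_conv_all_nth by metis
  qed
  with Comp.IH(2) ys'(2) show ?case by blast
next
  case (PrimRec_0 f xs y g)
  from PrimRec_0.prems PrimRec_0.IH show ?case by (blast elim: rec_eval_PrimRec_0E)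
next
  case (PrimRec_Suc f g n xs y u)
  from PrimRec_Suc.prems obtain y' where
    "rec_eval (PrimRec f g) (n # xs) y'" "rec_eval g (n # y' # xs) z"
    by (rule rec_eval_PrimRec_SucE)
  with PrimRec_Suc.IH show ?case by blast
next
  case (Mu f n xs)
  from Mu.prems have z: "rec_eval f (z # xs) 0"
      "\<And>m. m < z \<Longrightarrow> \<exists>k. rec_eval f (m # xs) (Suc k)"
    by (rule rec_eval_MuE, blast)+
  show ?case
  proof (cases n z rule: linorder_cases)
    case less
    with z(2) Mu.IH(1) show ?thesis by blast
  next
    case greater
    with z(1) Mu.IH(2) show ?thesis by blast
  qed
qed

end

theory Submission
  imports Defs
begin

text \<open>
  A self-referential instance replaces a universal machine. For every recursive function \<open>r\<close> there
  is a formula \<open>T\<close> such that \<open>T \<and> I\<^sub>m\<close> is satisfiable iff \<open>r\<close> is defined on \<open>m\<close> with value 0,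
  where \<open>I\<^sub>m\<close> is a formula whose code is an explicit arithmetic expression in \<open>m\<close>. Suppose that
  \<open>d\<close> decides satisfiability, let \<open>r\<close> map the code \<open>m\<close> of any formula \<open>\<phi>\<close> to the value of \<open>d\<close> on
  the code of \<open>\<phi> \<and> I\<^sub>m\<close>, and let \<open>m\<close> be the code of the formula \<open>T\<close> for this \<open>r\<close>. Then \<open>T \<and> I\<^sub>m\<close>
  is satisfiable iff \<open>d\<close> rejects it.

  The formula \<open>T\<close> describes derivations. The graph of \<open>r\<close> is the least model of a finite Horn
  program whose only arithmetic primitives are \<open>x = 0\<close> and \<open>y = x + 1\<close>. A model of \<open>T\<close> is a
  sequence of clause instances, one per position, in which every body atom \<open>q(x\<^sub>1, \<dots>, x\<^sub>k)\<close> is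
  justified by a later instance whose head is equal to it; this is exactly what a vectorial test
  expresses. The sequence ends with pairwise distinct values standing for the numbers 0, 1, 2, \<dots>,
  and the two arithmetic primitives are vectorial tests into this block.
\<close>

section \<open>Horn programs with zero and successor\<close>

datatype 'p atom = IsZero nat | IsSuc nat nat | Call 'p "nat list"

datatype 'p clause = Clause (cpred: 'p) (chead: "nat list") (cbody: "'p atom list")

text \<open>Since \<open>w\<close> ranges over all assignments, body variables absent from the head
  are existentially quantified. The premises are split by kind of atom so that \<open>der\<close>
  occurs in them directly.\<close>

inductive der :: "'p clause list \<Rightarrow> 'p \<Rightarrow> nat list \<Rightarrow> bool" for prog where
  der_clause: "Clause p hs body \<in> set prog \<Longrightarrow>
    (\<And>x. IsZero x \<in> set body \<Longrightarrow> w x = 0) \<Longrightarrow>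
    (\<And>x y. IsSuc x y \<in> set body \<Longrightarrow> w y = Suc (w x)) \<Longrightarrow>
    (\<And>q xs. Call q xs \<in> set body \<Longrightarrow> der prog q (map w xs)) \<Longrightarrow>
    der prog p (map w hs)"

fun atom_holds :: "('p \<Rightarrow> nat list \<Rightarrow> bool) \<Rightarrow> (nat \<Rightarrow> nat) \<Rightarrow> 'p atom \<Rightarrow> bool" where
  "atom_holds H w (IsZero x) \<longleftrightarrow> w x = 0"
| "atom_holds H w (IsSuc x y) \<longleftrightarrow> w y = Suc (w x)"
| "atom_holds H w (Call q xs) \<longleftrightarrow> H q (map w xs)"

lemma der_step:
  assumes "c \<in> set prog" "\<forall>a\<in>set (cbody c). atom_holds (der prog) w a"
    "cpred c = p" "map w (chead c) = zs"
  shows "der prog p zs"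
proof -
  have "der prog (cpred c) (map w (chead c))"
    by (rule der_clause[of "cpred c" "chead c" "cbody c"]) (use assms(1,2) in force)+
  with assms show ?thesis by simp
qed

definition valid_clause :: "('p \<Rightarrow> nat list \<Rightarrow> bool) \<Rightarrow> 'p clause \<Rightarrow> bool" where
  "valid_clause H c \<longleftrightarrow>
    (\<forall>w. (\<forall>a\<in>set (cbody c). atom_holds H w a) \<longrightarrow> H (cpred c) (map w (chead c)))"

text \<open>\<open>der\<close> lies below every model of the program: rule induction, as a model is
  closed under each clause.\<close>

lemma der_sound:
  assumes "\<forall>c\<in>set prog. valid_clause H c" "der prog p zs"
  shows "H p zs"
  using assms(2)
proof induction
  case (der_clause p hs body w)
  have "atom_holds H w a" if "a \<in> set body" for a
    using der_clause that by (cases a) auto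
  with assms(1) der_clause(1) show ?case
    unfolding valid_clause_def by fastforce
qed

section \<open>Recursive functions as Horn programs\<close>

text \<open>
  \<open>Search f\<close> relates \<open>n\<close> to \<open>m # xs\<close> if \<open>n\<close> is the result of searching upwards from \<open>m\<close> for a
  zero of \<open>f\<close>.
\<close>

datatype rpred = Eval recf | Search recf

fun rpred_holds :: "rpred \<Rightarrow> nat list \<Rightarrow> bool" where
  "rpred_holds (Eval f) (y # xs) \<longleftrightarrow> rec_eval f xs y"
| "rpred_holds (Search f) (n # m # xs) \<longleftrightarrow> m \<le> n \<and> rec_eval f (n # xs) 0 \<and>
     (\<forall>l. m \<le> l \<and> l < n \<longrightarrow> (\<exists>k. rec_eval f (l # xs) (Suc k)))"
| "rpred_holds _ _ \<longleftrightarrow> False"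

text \<open>\<open>k\<close> is the arity, which \<open>recf\<close> leaves implicit but a clause
  has to fix. Each clause mirrors an evaluation rule. In \<open>PrimRec\<close>, variables 1, 2 and
  3 are the recursion argument, its predecessor and the value there. In the last clause for
  \<open>Search\<close>, 1 is the candidate, 4 the next one, 3 the value at the candidate and 2 the
  predecessor of that value, which makes it positive.\<close>

fun clauses :: "recf \<Rightarrow> nat \<Rightarrow> rpred clause list" where
  "clauses Zero k = [Clause (Eval Zero) (0 # [1..<1+k]) [IsZero 0]]"
| "clauses Succ k = [Clause (Eval Succ) [0, 1] [IsSuc 1 0]]"
| "clauses (Proj i) k = (if i < k then [Clause (Eval (Proj i)) (i # [0..<k]) []] else [])"
| "clauses (Comp f gs) k =
     (let n = length gs; xs = [Suc n..<Suc n + k] in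
      Clause (Eval (Comp f gs)) (0 # xs)
        (Call (Eval f) (0 # [1..<Suc n]) # map (\<lambda>j. Call (Eval (gs ! j)) (Suc j # xs)) [0..<n])
      # clauses f n @ concat (map (\<lambda>g. clauses g k) gs))"
| "clauses (PrimRec f g) k =
     (case k of 0 \<Rightarrow> [] | Suc k \<Rightarrow>
      let xs = [4..<4+k] in
      Clause (Eval (PrimRec f g)) (0 # 1 # xs) [IsZero 1, Call (Eval f) (0 # xs)]
      # Clause (Eval (PrimRec f g)) (0 # 1 # xs)
          [IsSuc 2 1, Call (Eval (PrimRec f g)) (3 # 2 # xs), Call (Eval g) (0 # 2 # 3 # xs)]
      # clauses f k @ clauses g (Suc (Suc k)))"
| "clauses (Mu f) k =
     (let xs = [5..<5+k] in
      Clause (Eval (Mu f)) (0 # xs) [IsZero 1, Call (Search f) (0 # 1 # xs)]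
      # Clause (Search f) (0 # 0 # xs) [IsZero 1, Call (Eval f) (1 # 0 # xs)]
      # Clause (Search f) (0 # 1 # xs)
          [IsSuc 2 3, IsSuc 1 4, Call (Eval f) (3 # 1 # xs), Call (Search f) (0 # 4 # xs)]
      # clauses f (Suc k))"

section \<open>Correctness of the translation into Horn clauses\<close>

lemma map_nth_append_upt:
  "length ys = m \<Longrightarrow> length xs = k \<Longrightarrow> map ((!) (ys @ xs)) [m..<m + k] = xs"
  by (rule nth_equalityI) (auto simp: nth_append)

lemma clauses_valid: "c \<in> set (clauses f k) \<Longrightarrow> valid_clause rpred_holds c"
proof (induction f k arbitrary: c rule: clauses.induct)
  case (1 k)
  then show ?case by (auto simp: valid_clause_def intro: rec_eval.Zero)
next
  case (2 k)
  then show ?case by (auto simp: valid_clause_def intro: rec_eval.Succ)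
next
  case (3 i k)
  have "rec_eval (Proj i) (map w [0..<k]) (w i)" if "i < k" for w
    using rec_eval.Proj[of i "map w [0..<k]"] that by simp
  with 3 show ?case by (auto simp: valid_clause_def split: if_splits)
next
  case (4 f gs k)
  let ?n = "length gs"
  let ?xs = "[Suc ?n..<Suc ?n + k]"
  have "rec_eval (Comp f gs) (map w ?xs) (w 0)"
    if f: "rec_eval f (map w [1..<Suc ?n]) (w 0)"
      and gs: "\<forall>j<?n. rec_eval (gs ! j) (map w ?xs) (w (Suc j))" for w
    by (rule rec_eval.Comp[OF _ f]) (use gs in \<open>auto simp: list_all2_conv_all_nth simp del: upt_Suc\<close>)
  then have "valid_clause rpred_holds (Clause (Eval (Comp f gs)) (0 # ?xs)
        (Call (Eval f) (0 # [1..<Suc ?n]) # map (\<lambda>j. Call (Eval (gs ! j)) (Suc j # ?xs)) [0..<?n]))"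
    by (auto simp: valid_clause_def simp del: upt_Suc)
  with 4 show ?case by (auto simp: Let_def simp del: upt_Suc)
next
  case (5 f g k)
  show ?case
  proof (cases k)
    case 0
    with 5 show ?thesis by simp
  next
    case (Suc k')
    with 5 show ?thesis
      by (auto simp: Let_def valid_clause_def simp del: upt_Suc
          intro: rec_eval.PrimRec_0 rec_eval.PrimRec_Suc)
  qed
next
  case (6 f k)
  let ?xs = "[5..<5+k]"
  have 1: "valid_clause rpred_holds
      (Clause (Eval (Mu f)) (0 # ?xs) [IsZero 1, Call (Search f) (0 # 1 # ?xs)])"
    by (auto simp: valid_clause_def simp del: upt_Suc intro!: rec_eval.Mu)
  have 2: "valid_clause rpred_holds
      (Clause (Search f) (0 # 0 # ?xs) [IsZero 1, Call (Eval f) (1 # 0 # ?xs)])"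
    by (auto simp: valid_clause_def simp del: upt_Suc)
  \<comment> \<open>A number from the candidate on is either the candidate, where the value is a
    successor, or in the range of the recursive call.\<close>
  have 3: "valid_clause rpred_holds (Clause (Search f) (0 # 1 # ?xs)
      [IsSuc 2 3, IsSuc 1 4, Call (Eval f) (3 # 1 # ?xs), Call (Search f) (0 # 4 # ?xs)])"
    by (auto simp: valid_clause_def simp del: upt_Suc)
      (use Suc_leI le_neq_implies_less in blast)
  from 1 2 3 6 show ?case by (auto simp: Let_def simp del: upt_Suc)
qed

text \<open>Inclusion in an arbitrary \<open>prog\<close> lets the induction pass to subfunctions,
  whose clauses are among those of the whole. Assignments are lookups in a list that ends with the
  arguments, after any auxiliary values.\<close>

lemma rec_eval_der:
  "rec_eval f xs y \<Longrightarrow> set (clauses f (length xs)) \<subseteq> set prog \<Longrightarrow> der prog (Eval f) (y # xs)"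
proof (induction rule: rec_eval.induct)
  case (Zero xs)
  let ?c = "Clause (Eval Zero) (0 # [1..<1 + length xs]) [IsZero 0]"
  show ?case
    by (rule der_step[of ?c _ "(!) ([0] @ xs)"])
      (use Zero map_nth_append_upt[of "[0]" 1 xs "length xs"] in \<open>simp_all del: upt_Suc\<close>)
next
  case (Succ x)
  show ?case
    by (rule der_step[of "Clause (Eval Succ) [0, 1] [IsSuc 1 0]" _ "(!) [Suc x, x]"])
      (use Succ in auto)
next
  case (Proj i xs)
  show ?case
    by (rule der_step[of "Clause (Eval (Proj i)) (i # [0..<length xs]) []" _ "(!) xs"])
      (use Proj in \<open>auto simp: map_nth\<close>)
next
  case (Comp xs gs ys f z)
  let ?n = "length gs"
  let ?xs = "[Suc ?n..<Suc ?n + length xs]"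
  let ?w = "(!) (([z] @ ys) @ xs)"
  have n: "length ys = ?n" using Comp.IH(1) by (simp add: list_all2_conv_all_nth)
  have xs: "map ?w ?xs = xs" by (rule map_nth_append_upt) (use n in auto)
  have "map ((!) ([z] @ ys)) [1..<1 + ?n] = ys" by (rule map_nth_append_upt) (use n in auto)
  moreover have "map ?w [1..<Suc ?n] = map ((!) ([z] @ ys)) [1..<1 + ?n]"
    using n by (auto simp: nth_append simp del: upt_Suc)
  ultimately have ys: "map ?w [1..<Suc ?n] = ys" by simp
  have sub: "set (clauses (gs ! j) (length xs)) \<subseteq> set prog" if "j < ?n" for j
    using Comp.prems nth_mem[OF that] by (auto simp: Let_def simp del: upt_Suc)
  have gs: "der prog (Eval (gs ! j)) (?w (Suc j) # map ?w ?xs)" if "j < ?n" for j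
    unfolding xs using Comp.IH(1) sub[OF that] that n
    by (auto simp: list_all2_conv_all_nth nth_append)
  have f: "der prog (Eval f) (?w 0 # map ?w [1..<Suc ?n])"
    unfolding ys using Comp.IH(2) Comp.prems n by (auto simp: Let_def simp del: upt_Suc)
  let ?c = "Clause (Eval (Comp f gs)) (0 # ?xs)
        (Call (Eval f) (0 # [1..<Suc ?n]) # map (\<lambda>j. Call (Eval (gs ! j)) (Suc j # ?xs)) [0..<?n])"
  show ?case
  proof (rule der_step[of ?c _ ?w])
    show "?c \<in> set prog" using Comp.prems by (auto simp: Let_def simp del: upt_Suc)
    show "\<forall>a\<in>set (cbody ?c). atom_holds (der prog) ?w a"
      using f gs by (auto simp del: upt_Suc)
    show "map ?w (chead ?c) = z # xs" using xs by (simp del: upt_Suc)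
  qed simp
next
  case (PrimRec_0 f xs y g)
  let ?xs = "[4..<4 + length xs]"
  let ?c = "Clause (Eval (PrimRec f g)) (0 # 1 # ?xs) [IsZero 1, Call (Eval f) (0 # ?xs)]"
  let ?w = "(!) ([y, 0, 0, 0] @ xs)"
  have xs: "map ?w ?xs = xs" by (rule map_nth_append_upt) auto
  have f: "der prog (Eval f) (y # xs)"
    using PrimRec_0 by (auto simp: Let_def)
  show ?case
    by (rule der_step[of ?c _ ?w])
      (use PrimRec_0.prems xs f in \<open>auto simp: Let_def simp del: upt_Suc\<close>)
next
  case (PrimRec_Suc f g n xs y z)
  let ?xs = "[4..<4 + length xs]"
  let ?c = "Clause (Eval (PrimRec f g)) (0 # 1 # ?xs)
          [IsSuc 2 1, Call (Eval (PrimRec f g)) (3 # 2 # ?xs), Call (Eval g) (0 # 2 # 3 # ?xs)]"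
  let ?w = "(!) ([z, Suc n, n, y] @ xs)"
  have xs: "map ?w ?xs = xs" by (rule map_nth_append_upt) auto
  have "der prog (Eval (PrimRec f g)) (y # n # xs)" "der prog (Eval g) (z # n # y # xs)"
    using PrimRec_Suc by (auto simp: Let_def)
  then show ?case
    by (intro der_step[of ?c _ ?w])
      (use PrimRec_Suc.prems xs in \<open>auto simp: Let_def simp del: upt_Suc\<close>)
next
  case (Mu f n xs)
  let ?xs = "[5..<5 + length xs]"
  let ?c1 = "Clause (Eval (Mu f)) (0 # ?xs) [IsZero 1, Call (Search f) (0 # 1 # ?xs)]"
  let ?c2 = "Clause (Search f) (0 # 0 # ?xs) [IsZero 1, Call (Eval f) (1 # 0 # ?xs)]"
  let ?c3 = "Clause (Search f) (0 # 1 # ?xs)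
      [IsSuc 2 3, IsSuc 1 4, Call (Eval f) (3 # 1 # ?xs), Call (Search f) (0 # 4 # ?xs)]"
  have sub: "set (clauses f (length (m # xs))) \<subseteq> set prog" for m
    using Mu.prems by (auto simp: Let_def simp del: upt_Suc)
  have c: "?c1 \<in> set prog" "?c2 \<in> set prog" "?c3 \<in> set prog"
    using Mu.prems by (auto simp: Let_def simp del: upt_Suc)
  have xs: "map ((!) ([a, b, d, e, g] @ xs)) ?xs = xs" for a b d e g
    by (rule map_nth_append_upt) auto
  \<comment> \<open>The search is derived backwards, from the zero \<open>n\<close> down to the
    starting point.\<close>
  have "der prog (Search f) (n # m # xs)" if "m \<le> n" for m
    using that
  proof (induction rule: inc_induct)
    case base
    have "der prog (Eval f) (0 # n # xs)" using Mu.IH(1) sub by blast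
    then show ?case
      by (intro der_step[OF c(2), of "(!) ([n, 0, 0, 0, 0] @ xs)"])
        (use xs[of n 0 0 0 0] in \<open>simp_all del: upt_Suc\<close>)
  next
    case (step m)
    obtain k where "der prog (Eval f) (Suc k # m # xs)" using Mu.IH(2) step(2) sub by blast
    with step.IH show ?case
      by (intro der_step[OF c(3), of "(!) ([n, m, k, Suc k, Suc m] @ xs)"])
        (use xs[of n m k "Suc k" "Suc m"] in \<open>simp_all del: upt_Suc\<close>)
  qed
  then have "der prog (Search f) (n # 0 # xs)" by simp
  then show ?case
    by (intro der_step[OF c(1), of "(!) ([n, 0, 0, 0, 0] @ xs)"])
      (use xs[of n 0 0 0 0] in \<open>simp_all del: upt_Suc\<close>)
qed

lemma der_clauses_iff_rec_eval: "der (clauses f (length xs)) (Eval f) (y # xs) \<longleftrightarrow> rec_eval f xs y"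
proof
  show "rec_eval f xs y" if "der (clauses f (length xs)) (Eval f) (y # xs)"
    using der_sound[OF _ that, of rpred_holds] clauses_valid by simp
qed (rule rec_eval_der[OF _ subset_refl])

text \<open>Vectorial tests need vectors of length at least 1, hence the non-empty argument
  lists.\<close>

fun atom_wf :: "'p atom \<Rightarrow> bool" where
  "atom_wf (Call q xs) \<longleftrightarrow> xs \<noteq> []"
| "atom_wf _ \<longleftrightarrow> True"

fun clause_wf :: "'p clause \<Rightarrow> bool" where
  "clause_wf (Clause p hs body) \<longleftrightarrow> hs \<noteq> [] \<and> (\<forall>a\<in>set body. atom_wf a)"

lemma clauses_wf: "c \<in> set (clauses f k) \<Longrightarrow> clause_wf c"
proof (induction f k arbitrary: c rule: clauses.induct)
  case (4 f gs k)
  then show ?case by (auto simp: Let_def simp del: upt_Suc)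
next
  case (5 f g k)
  then show ?case by (cases k) (auto simp: Let_def simp del: upt_Suc)
next
  case (6 f k)
  then show ?case by (auto simp: Let_def simp del: upt_Suc)
qed (auto split: if_splits)

section \<open>Computable functions\<close>

definition computable :: "(nat \<Rightarrow> nat) \<Rightarrow> bool" where
  "computable f \<longleftrightarrow> (\<exists>r. \<forall>x. rec_eval r [x] (f x))"

definition computable2 :: "(nat \<Rightarrow> nat \<Rightarrow> nat) \<Rightarrow> bool" where
  "computable2 f \<longleftrightarrow> (\<exists>r. \<forall>x y. rec_eval r [x, y] (f x y))"

lemma computable_comp:
  assumes "computable f" "computable g"
  shows "computable (\<lambda>x. f (g x))"
proof -
  from assms obtain r s where "\<And>x. rec_eval r [x] (f x)" "\<And>x. rec_eval s [x] (g x)"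
    unfolding computable_def by blast
  then have "rec_eval (Comp r [s]) [x] (f (g x))" for x
    by (intro rec_eval.Comp[where ys = "[_]"]) auto
  then show ?thesis unfolding computable_def by blast
qed

lemma computable_comp2:
  assumes "computable2 f" "computable g" "computable h"
  shows "computable (\<lambda>x. f (g x) (h x))"
proof -
  from assms obtain r s t where "\<And>x y. rec_eval r [x, y] (f x y)"
      "\<And>x. rec_eval s [x] (g x)" "\<And>x. rec_eval t [x] (h x)"
    unfolding computable_def computable2_def by metis
  then have "rec_eval (Comp r [s, t]) [x] (f (g x) (h x))" for x
    by (intro rec_eval.Comp[where ys = "[_, _]"]) auto
  then show ?thesis unfolding computable_def by blast
qed

lemma computable_id: "computable (\<lambda>x. x)"
  unfolding computable_def using rec_eval.Proj[of 0 "[_]"] by auto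

lemma computable_Suc: "computable Suc"
  unfolding computable_def using rec_eval.Succ by blast

lemma computable_const: "computable (\<lambda>x. c)"
proof (induction c)
  case 0
  show ?case unfolding computable_def using rec_eval.Zero by blast
next
  case (Suc c)
  then show ?case using computable_comp[OF computable_Suc] by blast
qed

lemma computable2_add: "computable2 (+)"
proof -
  let ?r = "PrimRec (Proj 0) (Comp Succ [Proj 1])"
  have "rec_eval ?r [x, y] (x + y)" for x y
  proof (induction x)
    case 0
    show ?case using rec_eval.PrimRec_0[OF rec_eval.Proj[of 0 "[y]"]] by simp
  next
    case (Suc x)
    have "rec_eval (Comp Succ [Proj 1]) [x, x + y, y] (Suc (x + y))"
      by (rule rec_eval.Comp[of _ _ "[x + y]"])
        (use rec_eval.Proj[of 1 "[x, x + y, y]"] in \<open>auto intro: rec_eval.Succ\<close>)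
    with Suc show ?case by (auto intro: rec_eval.PrimRec_Suc)
  qed
  then show ?thesis unfolding computable2_def by blast
qed

lemmas computable_add = computable_comp2[OF computable2_add]

text \<open>The Cantor pairing behind \<open>list_encode\<close> sends \<open>(m, n)\<close> to
  \<open>triangle (m + n) + m\<close>.\<close>

lemma computable_triangle: "computable triangle"
proof -
  obtain r where r: "\<And>x y. rec_eval r [x, y] (x + y)"
    using computable2_add unfolding computable2_def by blast
  let ?g = "Comp r [Proj 1, Comp Succ [Proj 0]]"
  have "rec_eval (PrimRec Zero ?g) [n] (triangle n)" for n
  proof (induction n)
    case 0
    show ?case using rec_eval.PrimRec_0[OF rec_eval.Zero] by simp
  next
    case (Suc n)
    have "rec_eval (Comp Succ [Proj 0]) [n, triangle n] (Suc n)"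
      by (rule rec_eval.Comp[of _ _ "[n]"])
        (use rec_eval.Proj[of 0 "[n, triangle n]"] in \<open>auto intro: rec_eval.Succ\<close>)
    then have "rec_eval ?g [n, triangle n] (triangle n + Suc n)"
      by (intro rec_eval.Comp[of _ _ "[triangle n, Suc n]"] r)
        (use rec_eval.Proj[of 1 "[n, triangle n]"] in auto)
    with rec_eval.PrimRec_Suc[OF Suc] show ?case by simp
  qed
  then show ?thesis unfolding computable_def by blast
qed

lemma computable_list_encode_Cons:
  assumes "computable f" "computable (\<lambda>x. list_encode (g x))"
  shows "computable (\<lambda>x. list_encode (f x # g x))"
  unfolding list_encode.simps prod_encode_def prod.case
  by (intro computable_comp[OF computable_Suc] computable_comp[OF computable_triangle]
      computable_add assms)

section \<open>Formulas expressing Horn programs\<close>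

definition Top :: form where
  "Top = Neg (And (EqX 0 0 0) (Neg (EqX 0 0 0)))"

definition Or :: "form \<Rightarrow> form \<Rightarrow> form" where
  "Or \<phi> \<psi> = Neg (And (Neg \<phi>) (Neg \<psi>))"

definition Fut :: "form \<Rightarrow> form" where
  "Fut \<phi> = Until Top \<phi>"

definition Glob :: "form \<Rightarrow> form" where
  "Glob \<phi> = Neg (Fut (Neg \<phi>))"

definition Conjs :: "form list \<Rightarrow> form" where
  "Conjs \<phi>s = foldr And \<phi>s Top"

definition Disjs :: "form list \<Rightarrow> form" where
  "Disjs \<phi>s = foldr Or \<phi>s (Neg Top)"

lemma sat_derived [simp]:
  "sat \<sigma> i Top"
  "sat \<sigma> i (Or \<phi> \<psi>) \<longleftrightarrow> sat \<sigma> i \<phi> \<or> sat \<sigma> i \<psi>"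
  "sat \<sigma> i (Fut \<phi>) \<longleftrightarrow> (\<exists>j\<ge>i. j < length \<sigma> \<and> sat \<sigma> j \<phi>)"
  "sat \<sigma> i (Glob \<phi>) \<longleftrightarrow> (\<forall>j\<ge>i. j < length \<sigma> \<longrightarrow> sat \<sigma> j \<phi>)"
  by (auto simp: Top_def Or_def Fut_def Glob_def)

lemma sat_Conjs [simp]: "sat \<sigma> i (Conjs \<phi>s) \<longleftrightarrow> (\<forall>\<phi>\<in>set \<phi>s. sat \<sigma> i \<phi>)"
  by (induction \<phi>s) (auto simp: Conjs_def)

lemma sat_Disjs [simp]: "sat \<sigma> i (Disjs \<phi>s) \<longleftrightarrow> (\<exists>\<phi>\<in>set \<phi>s. sat \<sigma> i \<phi>)"
  by (induction \<phi>s) (auto simp: Disjs_def)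

lemma fragment_iff: "\<phi> \<in> LRV_vec_XU \<longleftrightarrow> vec_wf \<phi> \<and> past_free \<phi>"
  by (simp add: LRV_vec_XU_def LRV_vec_def)

lemma fragment_derived [simp]:
  "Top \<in> LRV_vec_XU"
  "Or \<phi> \<psi> \<in> LRV_vec_XU \<longleftrightarrow> \<phi> \<in> LRV_vec_XU \<and> \<psi> \<in> LRV_vec_XU"
  "Fut \<phi> \<in> LRV_vec_XU \<longleftrightarrow> \<phi> \<in> LRV_vec_XU"
  "Glob \<phi> \<in> LRV_vec_XU \<longleftrightarrow> \<phi> \<in> LRV_vec_XU"
  by (auto simp: fragment_iff Top_def Or_def Fut_def Glob_def)

lemma fragment_basic [simp]:
  "EqX x j y \<in> LRV_vec_XU"
  "EqTest x \<phi> y \<in> LRV_vec_XU \<longleftrightarrow> \<phi> \<in> LRV_vec_XU"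
  "VecEqTest xs \<phi> ys \<in> LRV_vec_XU \<longleftrightarrow> length xs = length ys \<and> xs \<noteq> [] \<and> \<phi> \<in> LRV_vec_XU"
  "And \<phi> \<psi> \<in> LRV_vec_XU \<longleftrightarrow> \<phi> \<in> LRV_vec_XU \<and> \<psi> \<in> LRV_vec_XU"
  "Neg \<phi> \<in> LRV_vec_XU \<longleftrightarrow> \<phi> \<in> LRV_vec_XU"
  "Next \<phi> \<in> LRV_vec_XU \<longleftrightarrow> \<phi> \<in> LRV_vec_XU"
  by (auto simp: fragment_iff)

lemma fragment_Conjs [simp]: "Conjs \<phi>s \<in> LRV_vec_XU \<longleftrightarrow> set \<phi>s \<subseteq> LRV_vec_XU"
  by (induction \<phi>s) (auto simp: Conjs_def)

lemma fragment_Disjs [simp]: "Disjs \<phi>s \<in> LRV_vec_XU \<longleftrightarrow> set \<phi>s \<subseteq> LRV_vec_XU"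
  by (induction \<phi>s) (auto simp: Disjs_def)

text \<open>
  The even LRV variable \<open>2 * x\<close> stands for the clause variable \<open>x\<close>; the odd ones encode Boolean
  tags, where equality with the LRV variable 1 means true. Tag \<open>t + 2\<close> marks the instances of
  clause \<open>t\<close>, tag 1 the number positions, and tag 0 the number position of zero. A number position
  carries its own value in clause variable 0 and that of its successor in clause variable 1.
\<close>

definition Tag :: "nat \<Rightarrow> form" where
  "Tag t = EqX (2 * t + 3) 0 1"

definition clause_value :: "valuation list \<Rightarrow> nat \<Rightarrow> nat \<Rightarrow> nat" where
  "clause_value \<sigma> i x = (\<sigma> ! i) (2 * x)"

text \<open>\<open>EqX 2 1 0\<close> ties the stored successor to the own value of the next position
  and forces that position to exist. The length filter keeps the two vectors equally long, as the
  fragment demands.\<close>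

primrec atom_form :: "'p clause list \<Rightarrow> 'p atom \<Rightarrow> form" where
  "atom_form prog (IsZero x) = EqTest (2 * x) (Tag 0) 0"
| "atom_form prog (IsSuc x y) = VecEqTest [2 * x, 2 * y] (And (Tag 1) (EqX 2 1 0)) [0, 2]"
| "atom_form prog (Call p xs) =
     Disjs (map (\<lambda>t. VecEqTest (map ((*) 2) xs) (Tag (t + 2)) (map ((*) 2) (chead (prog ! t))))
       (filter (\<lambda>t. cpred (prog ! t) = p \<and> length (chead (prog ! t)) = length xs)
         [0..<length prog]))"

lemma sat_atom_form:
  "sat \<sigma> i (atom_form prog (IsZero x)) \<longleftrightarrow>
    (\<exists>j>i. j < length \<sigma> \<and> clause_value \<sigma> i x = clause_value \<sigma> j 0 \<and> sat \<sigma> j (Tag 0))"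
  "sat \<sigma> i (atom_form prog (IsSuc x y)) \<longleftrightarrow>
    (\<exists>j>i. Suc j < length \<sigma> \<and> sat \<sigma> j (Tag 1) \<and> clause_value \<sigma> i x = clause_value \<sigma> j 0 \<and>
      clause_value \<sigma> i y = clause_value \<sigma> j 1 \<and>
      clause_value \<sigma> j 1 = clause_value \<sigma> (Suc j) 0)"
  "sat \<sigma> i (atom_form prog (Call p xs)) \<longleftrightarrow>
    (\<exists>t<length prog. cpred (prog ! t) = p \<and> (\<exists>j>i. j < length \<sigma> \<and> sat \<sigma> j (Tag (t + 2)) \<and>
      map (clause_value \<sigma> i) xs = map (clause_value \<sigma> j) (chead (prog ! t))))"
proof -
  have "clause_value \<sigma> i = (\<sigma> ! i) \<circ> (*) 2" for i
    by (auto simp: clause_value_def)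
  then have "map (clause_value \<sigma> i) xs = map (clause_value \<sigma> j) ys \<longleftrightarrow> length ys = length xs \<and>
      map (\<sigma> ! i) (map ((*) 2) xs) = map (\<sigma> ! j) (map ((*) 2) ys)" for j ys
    by (auto dest: map_eq_imp_length_eq)
  then show "sat \<sigma> i (atom_form prog (Call p xs)) \<longleftrightarrow>
    (\<exists>t<length prog. cpred (prog ! t) = p \<and> (\<exists>j>i. j < length \<sigma> \<and> sat \<sigma> j (Tag (t + 2)) \<and>
      map (clause_value \<sigma> i) xs = map (clause_value \<sigma> j) (chead (prog ! t))))"
    by (fastforce simp del: map_map)
qed (auto simp: clause_value_def)

text \<open>
  The input is transferred from clause variable 1 of the first position to clause variable 2 of
  the position of zero, where \<open>input_form\<close> fixes its value.
\<close>

definition program_form :: "'p clause list \<Rightarrow> 'p \<Rightarrow> form" where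
  "program_form prog p = Conjs (
     [atom_form prog (IsZero 0), atom_form prog (Call p [0, 1]), EqTest 2 (Tag 0) 4,
      Glob (Or (Neg (Tag 0)) (Tag 1)),
      Glob (Or (Neg (Tag 1)) (Neg (Next (Fut (Tag 0))))),
      Glob (Or (Neg (Tag 1)) (Or (Neg (Next Top)) (Next (Tag 1)))),
      Glob (Or (Neg (Tag 1)) (Neg (EqTest 0 (Tag 1) 0)))] @
     map (\<lambda>t. Glob (Or (Neg (Tag (t + 2))) (Conjs (map (atom_form prog) (cbody (prog ! t))))))
       [0..<length prog])"

text \<open>The input is measured as the distance from the position of zero. It enters only as the
  offset of one atom, so the shape of the formula is the same for all \<open>m\<close>.\<close>

definition input_form :: "nat \<Rightarrow> form" where
  "input_form m = Fut (And (Tag 0) (EqX 4 m 0))"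

lemma fragment_Tag [simp]: "Tag t \<in> LRV_vec_XU"
  by (simp add: Tag_def)

lemma program_form_fragment:
  assumes "\<forall>c\<in>set prog. clause_wf c"
  shows "program_form prog p \<in> LRV_vec_XU"
proof -
  have atom: "atom_form prog a \<in> LRV_vec_XU" if "atom_wf a" for a
    using that by (cases a) auto
  have "atom_wf a" if "t < length prog" "a \<in> set (cbody (prog ! t))" for t a
    using assms that nth_mem[OF that(1)] by (cases "prog ! t") fastforce
  with atom atom[of "IsZero 0"] atom[of "Call p [0, 1]"] show ?thesis
    by (auto simp: program_form_def simp del: atom_form.simps)
qed

text \<open>Once a position of zero exists, the tag conditions make the number positions the final
  segment of the model that starts there, with pairwise distinct own values.\<close>

lemma sat_program_form:
  "sat \<sigma> 0 (program_form prog p) \<longleftrightarrow>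
     sat \<sigma> 0 (atom_form prog (IsZero 0)) \<and> sat \<sigma> 0 (atom_form prog (Call p [0, 1])) \<and>
     (\<exists>j>0. j < length \<sigma> \<and> clause_value \<sigma> 0 1 = clause_value \<sigma> j 2 \<and> sat \<sigma> j (Tag 0)) \<and>
     (\<forall>i<length \<sigma>. sat \<sigma> i (Tag 0) \<longrightarrow> sat \<sigma> i (Tag 1)) \<and>
     (\<forall>j<length \<sigma>. \<forall>i<j. sat \<sigma> i (Tag 1) \<longrightarrow> \<not> sat \<sigma> j (Tag 0)) \<and>
     (\<forall>i. Suc i < length \<sigma> \<longrightarrow> sat \<sigma> i (Tag 1) \<longrightarrow> sat \<sigma> (Suc i) (Tag 1)) \<and>
     (\<forall>j<length \<sigma>. \<forall>i<j. sat \<sigma> i (Tag 1) \<longrightarrow> sat \<sigma> j (Tag 1) \<longrightarrow>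
        clause_value \<sigma> i 0 \<noteq> clause_value \<sigma> j 0) \<and>
     (\<forall>t<length prog. \<forall>i<length \<sigma>. sat \<sigma> i (Tag (t + 2)) \<longrightarrow>
        (\<forall>a\<in>set (cbody (prog ! t)). sat \<sigma> i (atom_form prog a)))"
proof -
  have 1: "sat \<sigma> 0 (EqTest 2 (Tag 0) 4) \<longleftrightarrow>
      (\<exists>j>0. j < length \<sigma> \<and> clause_value \<sigma> 0 1 = clause_value \<sigma> j 2 \<and> sat \<sigma> j (Tag 0))"
    by (simp add: clause_value_def)
  have 2: "sat \<sigma> 0 (Glob (Or (Neg (Tag 0)) (Tag 1))) \<longleftrightarrow>
      (\<forall>i<length \<sigma>. sat \<sigma> i (Tag 0) \<longrightarrow> sat \<sigma> i (Tag 1))"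
    by auto
  have 3: "sat \<sigma> 0 (Glob (Or (Neg (Tag 1)) (Neg (Next (Fut (Tag 0)))))) \<longleftrightarrow>
      (\<forall>j<length \<sigma>. \<forall>i<j. sat \<sigma> i (Tag 1) \<longrightarrow> \<not> sat \<sigma> j (Tag 0))"
    by (simp add: Suc_le_eq) (meson less_trans le_less_trans Suc_leI)
  have 4: "sat \<sigma> 0 (Glob (Or (Neg (Tag 1)) (Or (Neg (Next Top)) (Next (Tag 1))))) \<longleftrightarrow>
      (\<forall>i. Suc i < length \<sigma> \<longrightarrow> sat \<sigma> i (Tag 1) \<longrightarrow> sat \<sigma> (Suc i) (Tag 1))"
    by (auto dest: Suc_lessD)
  have 5: "sat \<sigma> 0 (Glob (Or (Neg (Tag 1)) (Neg (EqTest 0 (Tag 1) 0)))) \<longleftrightarrow>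
      (\<forall>j<length \<sigma>. \<forall>i<j. sat \<sigma> i (Tag 1) \<longrightarrow> sat \<sigma> j (Tag 1) \<longrightarrow>
        clause_value \<sigma> i 0 \<noteq> clause_value \<sigma> j 0)"
    by (simp add: clause_value_def) (meson less_trans)
  have 6: "sat \<sigma> 0 (Glob (Or (Neg (Tag (t + 2))) (Conjs (map (atom_form prog) as)))) \<longleftrightarrow>
      (\<forall>i<length \<sigma>. sat \<sigma> i (Tag (t + 2)) \<longrightarrow> (\<forall>a\<in>set as. sat \<sigma> i (atom_form prog a)))" for t as
    by auto
  show ?thesis
    unfolding program_form_def sat_Conjs set_append ball_Un set_map ball_simps set_upt
      list.set 1 2 3 4 5 6
    by (simp only: atLeastLessThan_iff le0 simp_thms Ball_def conj_assoc)
qed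

lemma sat_input_form:
  "sat \<sigma> 0 (input_form m) \<longleftrightarrow> (\<exists>i. i + m < length \<sigma> \<and> sat \<sigma> i (Tag 0) \<and>
     clause_value \<sigma> i 2 = clause_value \<sigma> (i + m) 0)"
  by (simp add: input_form_def clause_value_def) (meson add_lessD1)

lemma input_form_fragment: "input_form m \<in> LRV_vec_XU"
  by (simp add: input_form_def)

subsection \<open>From models to derivations\<close>

text \<open>With the own value of position \<open>z + n\<close> read as the number \<open>n\<close>,
  every tagged clause instance is derivable, by induction from the end of the model, since tests
  look strictly ahead.\<close>

lemma program_form_sound:
  assumes "sat \<sigma> 0 (program_form prog p)" "sat \<sigma> 0 (input_form m)"
  shows "der prog p [0, m]"
proof -
  let ?L = "length \<sigma>" and ?v = "clause_value \<sigma>"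
  from assms(2) obtain z where z: "z + m < ?L" "sat \<sigma> z (Tag 0)" "?v z 2 = ?v (z + m) 0"
    by (auto simp: sat_input_form)
  note prog = assms(1)[unfolded sat_program_form]
  have zero: "sat \<sigma> 0 (atom_form prog (IsZero 0))"
    and call: "sat \<sigma> 0 (atom_form prog (Call p [0, 1]))"
    and inp: "\<exists>j>0. j < ?L \<and> ?v 0 1 = ?v j 2 \<and> sat \<sigma> j (Tag 0)"
    using prog by blast+
  have N0: "sat \<sigma> i (Tag 1)" if "i < ?L" "sat \<sigma> i (Tag 0)" for i
    using prog that by blast
  have N1: "\<not> sat \<sigma> j (Tag 0)" if "i < j" "j < ?L" "sat \<sigma> i (Tag 1)" for i j
    using prog that by blast
  have N2: "sat \<sigma> (Suc i) (Tag 1)" if "Suc i < ?L" "sat \<sigma> i (Tag 1)" for i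
    using prog that by blast
  have N3: "?v i 0 \<noteq> ?v j 0" if "i < j" "j < ?L" "sat \<sigma> i (Tag 1)" "sat \<sigma> j (Tag 1)" for i j
    using prog that by blast
  have clause: "sat \<sigma> i (atom_form prog a)"
    if "i < ?L" "t < length prog" "sat \<sigma> i (Tag (t + 2))" "a \<in> set (cbody (prog ! t))" for i t a
    using prog that by blast
  have zero_pos: "i = z" if "i < ?L" "sat \<sigma> i (Tag 0)" for i
    using that z N0[of i] N0[of z] N1[of i z] N1[of z i] by (cases i z rule: linorder_cases) auto
  have num: "sat \<sigma> (z + n) (Tag 1)" if "z + n < ?L" for n
    using that
  proof (induction n)
    case 0
    then show ?case using N0 z(2) by simp
  next
    case (Suc n)
    then show ?case using N2[of "z + n"] by simp
  qed
  have num_pos: "\<exists>n. i = z + n" if "i < ?L" "sat \<sigma> i (Tag 1)" for i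
    using that z N1[of i z] by (intro exI[of _ "i - z"]) (cases "i < z"; simp)
  \<comment> \<open>A value outside the number block gets some fixed number. Equal values still get
    equal numbers, and satisfied arithmetic atoms only concern values of the block.\<close>
  define W where "W a = (SOME n. z + n < ?L \<and> ?v (z + n) 0 = a)" for a
  have W: "W (?v (z + n) 0) = n" if n: "z + n < ?L" for n
  proof -
    have "n' = n" if "z + n' < ?L" "?v (z + n') 0 = ?v (z + n) 0" for n'
      using that n num[of n] num[of n'] N3[of "z + n'" "z + n"] N3[of "z + n" "z + n'"]
      by (cases n n' rule: linorder_cases) auto
    with n show ?thesis unfolding W_def by (intro some_equality) auto
  qed
  have atom: "atom_holds (der prog) (W \<circ> ?v i) a"
    if "sat \<sigma> i (atom_form prog a)"
      and IH: "\<And>j t. i < j \<Longrightarrow> j < ?L \<Longrightarrow> t < length prog \<Longrightarrow> sat \<sigma> j (Tag (t + 2)) \<Longrightarrow>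
        der prog (cpred (prog ! t)) (map (W \<circ> ?v j) (chead (prog ! t)))" for i a
  proof (cases a)
    case (IsZero x)
    with that(1) obtain j where "j < ?L" "?v i x = ?v j 0" "sat \<sigma> j (Tag 0)"
      unfolding IsZero sat_atom_form by blast
    with zero_pos W[of 0] IsZero show ?thesis by simp
  next
    case (IsSuc x y)
    with that(1) obtain j where j: "Suc j < ?L" "sat \<sigma> j (Tag 1)" "?v i x = ?v j 0"
        "?v i y = ?v (Suc j) 0"
      unfolding IsSuc sat_atom_form by force
    from j num_pos[of j] obtain n where "j = z + n" by auto
    with j W[of n] W[of "Suc n"] IsSuc show ?thesis by simp
  next
    case (Call q xs)
    with that(1) obtain t j where j: "t < length prog" "cpred (prog ! t) = q" "i < j" "j < ?L"
        "sat \<sigma> j (Tag (t + 2))" "map (?v i) xs = map (?v j) (chead (prog ! t))"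
      unfolding Call sat_atom_form by blast
    from j(6) have "map (W \<circ> ?v i) xs = map (W \<circ> ?v j) (chead (prog ! t))"
      by (metis map_map)
    with IH[of j t] j Call show ?thesis by simp
  qed
  have der: "der prog (cpred (prog ! t)) (map (W \<circ> ?v i) (chead (prog ! t)))"
    if "i < ?L" "t < length prog" "sat \<sigma> i (Tag (t + 2))" for i t
    using that
  proof (induction "?L - i" arbitrary: i t rule: less_induct)
    case less
    have "atom_holds (der prog) (W \<circ> ?v i) a" if "a \<in> set (cbody (prog ! t))" for a
      by (rule atom[OF clause[OF less.prems that]])
        (use less.prems in \<open>auto intro!: less.hyps\<close>)
    then show ?case using less.prems by (intro der_step[of "prog ! t" _ "W \<circ> ?v i"]) auto
  qed
  have "W (?v 0 0) = 0" using atom[OF zero der] by simp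
  \<comment> \<open>Clause variable 1 of position 0 equals clause variable 2 of the unique position
    of zero, which is the own value of position \<open>z + m\<close>.\<close>
  moreover have "W (?v 0 1) = m" using inp zero_pos z(3) W[OF z(1)] by auto
  moreover have "der prog p (map (W \<circ> ?v 0) [0, 1])" using atom[OF call der] by simp
  ultimately show ?thesis by simp
qed

subsection \<open>From derivations to models\<close>

text \<open>A pair \<open>(t, w)\<close> stands for the instance of clause \<open>t\<close> under the assignment \<open>w\<close>.\<close>

definition derived_in :: "'p clause list \<Rightarrow> (nat \<times> (nat \<Rightarrow> nat)) list \<Rightarrow> 'p \<Rightarrow> nat list \<Rightarrow> bool" where
  "derived_in prog ds q zs \<longleftrightarrow> (\<exists>(t, w)\<in>set ds. t < length prog \<and> cpred (prog ! t) = q \<and>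
     map w (chead (prog ! t)) = zs)"

text \<open>A derivation is a list in which every instance relies only on those after it, to match
  tests that look forward.\<close>

primrec justified :: "'p clause list \<Rightarrow> (nat \<times> (nat \<Rightarrow> nat)) list \<Rightarrow> bool" where
  "justified prog [] \<longleftrightarrow> True"
| "justified prog (d # ds) \<longleftrightarrow> fst d < length prog \<and>
     (\<forall>a\<in>set (cbody (prog ! fst d)). atom_holds (derived_in prog ds) (snd d) a) \<and>
     justified prog ds"

lemma atom_holds_mono:
  "(\<And>q zs. H q zs \<Longrightarrow> H' q zs) \<Longrightarrow> atom_holds H w a \<Longrightarrow> atom_holds H' w a"
  by (cases a) auto

lemma derived_in_mono: "set ds \<subseteq> set ds' \<Longrightarrow> derived_in prog ds q zs \<Longrightarrow> derived_in prog ds' q zs"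
  unfolding derived_in_def by blast

lemma justified_append: "justified prog ds \<Longrightarrow> justified prog ds' \<Longrightarrow> justified prog (ds @ ds')"
proof (induction ds)
  case (Cons d ds)
  have "atom_holds (derived_in prog (ds @ ds')) w a" if "atom_holds (derived_in prog ds) w a" for w a
    using that by (rule atom_holds_mono[rotated]) (erule derived_in_mono[rotated], simp)
  with Cons show ?case by auto
qed simp

lemma justified_nth:
  "justified prog ds \<Longrightarrow> k < length ds \<Longrightarrow> fst (ds ! k) < length prog \<and>
    (\<forall>a\<in>set (cbody (prog ! fst (ds ! k))).
      atom_holds (derived_in prog (drop (Suc k) ds)) (snd (ds ! k)) a)"
  by (induction ds arbitrary: k) (auto simp: nth_Cons split: nat.splits)

lemma der_justified: "der prog p zs \<Longrightarrow> \<exists>ds. justified prog ds \<and> derived_in prog ds p zs"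
proof (induction rule: der.induct)
  case (der_clause p hs body w)
  \<comment> \<open>The derivations of the body atoms are concatenated one atom at a time; further
    instances never destroy a justification.\<close>
  have "\<exists>ds. justified prog ds \<and> (\<forall>a\<in>set as. atom_holds (derived_in prog ds) w a)"
    if "set as \<subseteq> set body" for as
    using that
  proof (induction as)
    case Nil
    show ?case by (rule exI[of _ "[]"]) simp
  next
    case (Cons a as)
    then obtain ds where ds: "justified prog ds" "\<forall>a\<in>set as. atom_holds (derived_in prog ds) w a"
      by auto
    have "\<exists>ds'. justified prog ds' \<and> atom_holds (derived_in prog ds') w a"
    proof (cases a)
      case (Call q xs)
      with der_clause(5)[of q xs] Cons.prems show ?thesis by auto
    \<comment> \<open>Arithmetic atoms do not depend on the list of instances, so the empty one will
      do.\<close>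
    qed (use der_clause(2,3) Cons.prems in \<open>auto intro!: exI[of _ "[]"]\<close>)
    then obtain ds' where ds': "justified prog ds'" "atom_holds (derived_in prog ds') w a"
      by blast
    have "atom_holds (derived_in prog (ds @ ds')) w b" if "b \<in> set (a # as)" for b
    proof -
      from that ds(2) ds'(2)
      have "atom_holds (derived_in prog ds) w b \<or> atom_holds (derived_in prog ds') w b"
        by auto
      then show ?thesis
        by (elim disjE; elim atom_holds_mono[rotated] derived_in_mono[rotated]) auto
    qed
    with justified_append[OF ds(1) ds'(1)] show ?case by blast
  qed
  from this[of body] obtain ds where ds: "justified prog ds"
      "\<forall>a\<in>set body. atom_holds (derived_in prog ds) w a"
    by blast
  from der_clause(1) obtain t where t: "t < length prog" "prog ! t = Clause p hs body"
    by (metis in_set_conv_nth)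
  with ds have "justified prog ((t, w) # ds)" "derived_in prog ((t, w) # ds) p (map w hs)"
    by (auto simp: derived_in_def)
  then show ?case by blast
qed

text \<open>The value 0 serves as true and 1 as false; variable 1 holds the value for true.\<close>

definition tagged_valuation :: "nat set \<Rightarrow> (nat \<Rightarrow> nat) \<Rightarrow> valuation" where
  "tagged_valuation T w y =
    (if even y then w (y div 2) else if y = 1 \<or> (y - 3) div 2 \<in> T then 0 else 1)"

lemma tagged_model:
  assumes "\<sigma> = map (\<lambda>i. tagged_valuation (T i) (w i)) [0..<L]"
  shows "length \<sigma> = L"
    and "i < L \<Longrightarrow> clause_value \<sigma> i = w i"
    and "i < L \<Longrightarrow> sat \<sigma> i (Tag t) \<longleftrightarrow> t \<in> T i"
  using assms by (auto simp: fun_eq_iff clause_value_def Tag_def tagged_valuation_def)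

text \<open>Position 0 holds the query, positions 1 to \<open>K\<close> the instances of a
  derivation, and position \<open>Suc K + n\<close> the number \<open>n\<close>.\<close>

lemma program_form_complete:
  assumes "der prog p [0, m]"
  shows "\<exists>\<sigma>. \<sigma> \<noteq> [] \<and> sat \<sigma> 0 (program_form prog p) \<and> sat \<sigma> 0 (input_form m)"
proof -
  from der_justified[OF assms] obtain ds where
    ds: "justified prog ds" "derived_in prog ds p [0, m]" by blast
  define K where "K = length ds"
  \<comment> \<open>Only finitely many successors occur in the derivation, so some \<open>B\<close>
    bounds them.\<close>
  have "finite (\<Union>(t, w)\<in>set ds. \<Union>a\<in>set (cbody (prog ! t)). case a of IsSuc x y \<Rightarrow> {w y} | _ \<Rightarrow> {})"
    by (auto split: atom.splits)
  then obtain B where "\<forall>n\<in>(\<Union>(t, w)\<in>set ds. \<Union>a\<in>set (cbody (prog ! t)).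
      case a of IsSuc x y \<Rightarrow> {w y} | _ \<Rightarrow> {}). n \<le> B"
    using finite_nat_set_iff_bounded_le by blast
  then have B: "w y \<le> B" if "(t, w) \<in> set ds" "IsSuc x y \<in> set (cbody (prog ! t))" for t w x y
    using that by force
  \<comment> \<open>The block contains the numbers up to \<open>max B m\<close>: up to
    \<open>B\<close> for the successor atoms, up to \<open>m\<close> for the input.\<close>
  define L where "L = Suc K + Suc (max B m)"
  define T where "T i = (if i = 0 then {} else if i \<le> K then {fst (ds ! (i - 1)) + 2}
    else if i = Suc K then {0, 1} else {1::nat})" for i
  define w where "w i = (if i = 0 then (\<lambda>x. if x = 1 then m else 0)
    else if i \<le> K then snd (ds ! (i - 1))
    else (\<lambda>x. if x = 0 then i - Suc K else if x = 1 then i - K else m))" for i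
  define \<sigma> where "\<sigma> = map (\<lambda>i. tagged_valuation (T i) (w i)) [0..<L]"
  note [simp] = tagged_model[OF \<sigma>_def]
  have num: "Suc K + n < L \<longleftrightarrow> n \<le> max B m" for n
    by (auto simp: L_def)
  have T0: "0 \<in> T i \<longleftrightarrow> i = Suc K" and T1: "1 \<in> T i \<longleftrightarrow> K < i" for i
    by (auto simp: T_def)
  have Tc: "t + 2 \<in> T i \<longleftrightarrow> (\<exists>k<K. i = Suc k \<and> t = fst (ds ! k))" for t i
    by (cases i) (auto simp: T_def)
  have wK: "w (Suc K + n) 0 = n" "w (Suc K + n) (Suc 0) = Suc n" "w (Suc K + n) 2 = m" for n
    by (auto simp: w_def)
  have wc: "w (Suc k) = snd (ds ! k)" if "k < K" for k
    using that by (simp add: w_def)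
  \<comment> \<open>Entry \<open>ds ! k\<close> sits at position \<open>Suc k\<close>, so
    \<open>drop i ds\<close> lists the instances after position \<open>i\<close>, also for the query
    at 0.\<close>
  have atom: "sat \<sigma> i (atom_form prog a)"
    if "i \<le> K" "atom_holds (derived_in prog (drop i ds)) (w i) a"
      "\<And>x y. a = IsSuc x y \<Longrightarrow> w i y \<le> B" for i a
  proof -
    have [simp]: "i < L" using that(1) by (simp add: L_def)
    show ?thesis
    proof (cases a)
      case (IsZero x)
      have "sat \<sigma> i (atom_form prog (IsZero x))"
        unfolding sat_atom_form
        by (rule exI[of _ "Suc K"]) (use that IsZero num[of 0] wK[of 0] T0 in simp)
      with IsZero show ?thesis by simp
    next
      case (IsSuc x y)
      have "w i y = Suc (w i x)" "w i y \<le> B" using that IsSuc by auto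
      then have "sat \<sigma> i (atom_form prog (IsSuc x y))"
        unfolding sat_atom_form
        by (intro exI[of _ "Suc K + w i x"])
          (use that(1) num[of "w i x"] num[of "Suc (w i x)"] wK[of "w i x"] wK[of "Suc (w i x)"] T1
            in \<open>simp add: le_max_iff_disj\<close>)
      with IsSuc show ?thesis by simp
    next
      case (Call q xs)
      with that(2) obtain d where d: "d \<in> set (drop i ds)" "fst d < length prog"
          "cpred (prog ! fst d) = q" "map (snd d) (chead (prog ! fst d)) = map (w i) xs"
        by (auto simp: derived_in_def)
      from d(1) obtain k where k: "k < K - i" "d = ds ! (i + k)"
        by (auto simp: in_set_conv_nth K_def)
      have "sat \<sigma> i (atom_form prog (Call q xs))"
        unfolding sat_atom_form
        by (rule exI[of _ "fst d"], intro conjI exI[of _ "Suc (i + k)"])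
          (use d k that(1) Tc[of "fst d" "Suc (i + k)"] wc[of "i + k"] num[of 0] in auto)
      with Call show ?thesis by simp
    qed
  qed
  have pos: "0 < L" "Suc K < L" by (auto simp: L_def)
  have "sat \<sigma> 0 (atom_form prog (IsZero 0))" by (rule atom) (auto simp: w_def)
  moreover have "sat \<sigma> 0 (atom_form prog (Call p [0, 1]))"
    by (rule atom) (use ds(2) in \<open>auto simp: w_def\<close>)
  moreover have "clause_value \<sigma> 0 1 = clause_value \<sigma> (Suc K) 2" "sat \<sigma> (Suc K) (Tag 0)"
    using pos wK(3)[of 0] T0 by (simp_all add: w_def)
  moreover have "clause_value \<sigma> i 0 \<noteq> clause_value \<sigma> j 0" if "i < j" "j < L" "K < i" for i j
    using that by (simp add: w_def)
  moreover have "sat \<sigma> i (atom_form prog a)"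
    if "i < L" "t + 2 \<in> T i" "a \<in> set (cbody (prog ! t))" for i t a
  proof -
    from that(2) Tc obtain k where k: "k < K" "i = Suc k" "t = fst (ds ! k)" by auto
    have "(t, w i) \<in> set ds" using k wc nth_mem[of k ds] by (simp add: K_def)
    with k that justified_nth[OF ds(1), of k] B[of t "w i"] wc show ?thesis
      by (intro atom) (auto simp: K_def)
  qed
  ultimately have "sat \<sigma> 0 (program_form prog p)"
    unfolding sat_program_form using pos T0 T1 by (auto simp del: atom_form.simps)
  moreover have "sat \<sigma> 0 (input_form m)"
  proof -
    have "clause_value \<sigma> (Suc K) 2 = clause_value \<sigma> (Suc K + m) 0"
      using num[of m] num[of 0] wK(3)[of 0] wK(1)[of m] by simp
    with pos num[of m] T0 show ?thesis
      unfolding sat_input_form by (intro exI[of _ "Suc K"]) simp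
  qed
  moreover have "\<sigma> \<noteq> []" using pos by (simp add: \<sigma>_def)
  ultimately show ?thesis by blast
qed

section \<open>Undecidability\<close>

definition recf_form :: "recf \<Rightarrow> form" where
  "recf_form r = program_form (clauses r 1) (Eval r)"

lemma recf_form_fragment: "And (recf_form r) (input_form m) \<in> LRV_vec_XU"
  using clauses_wf[of _ r 1] program_form_fragment[of "clauses r 1"] input_form_fragment
  by (simp add: recf_form_def)

lemma satisfiable_recf_form:
  "satisfiable (And (recf_form r) (input_form m)) \<longleftrightarrow> rec_eval r [m] 0"
  using program_form_sound[of _ "clauses r 1" "Eval r" m]
    program_form_complete[of "clauses r 1" "Eval r" m] der_clauses_iff_rec_eval[of r "[m]" 0]
  by (auto simp: satisfiable_def recf_form_def)

text \<open>The number 4 is that of the constructor \<open>And\<close>: if \<open>m\<close> is the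
  code of a formula, this is the code of its conjunction with \<open>input_form m\<close>, obtained
  without decoding \<open>m\<close>.\<close>

definition diagonal_code :: "nat \<Rightarrow> nat" where
  "diagonal_code m = list_encode [4, m, form_encode (input_form m)]"

lemma computable_diagonal_code: "computable diagonal_code"
proof -
  have "computable (\<lambda>m. list_encode [4, m, list_encode [7, form_encode Top,
      list_encode [4, form_encode (Tag 0), list_encode [0, 4, m, 0]]]])"
    by (intro computable_list_encode_Cons computable_const computable_id)
  then show ?thesis
    by (simp add: diagonal_code_def[abs_def] input_form_def Fut_def del: list_encode.simps)
qed

theorem theorem6p9: "\<not> decidable form_encode LRV_vec_XU satisfiable"
proof
  assume "decidable form_encode LRV_vec_XU satisfiable"
  then obtain r where r: "\<And>\<phi>. \<phi> \<in> LRV_vec_XU \<Longrightarrow>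
      rec_eval r [form_encode \<phi>] (if satisfiable \<phi> then 1 else 0)"
    unfolding decidable_def by blast
  from computable_diagonal_code obtain s where s: "\<And>m. rec_eval s [m] (diagonal_code m)"
    unfolding computable_def by blast
  \<comment> \<open>On the code of a formula, \<open>Comp r [s]\<close> returns the verdict of
    \<open>r\<close> on the conjunction of that formula with the input formula for its code. For
    \<open>\<psi>\<close> this conjunction is \<open>\<phi>\<close>, which is satisfiable iff the
    verdict on it is 0.\<close>
  define \<psi> where "\<psi> = recf_form (Comp r [s])"
  define m where "m = form_encode \<psi>"
  define \<phi> where "\<phi> = And \<psi> (input_form m)"
  have code: "form_encode \<phi> = diagonal_code m"
    by (simp add: \<phi>_def m_def diagonal_code_def)
  have eval: "rec_eval r [form_encode \<phi>] (if satisfiable \<phi> then 1 else 0)"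
    by (rule r) (unfold \<phi>_def \<psi>_def, rule recf_form_fragment)
  then have "rec_eval (Comp r [s]) [m] (if satisfiable \<phi> then 1 else 0)"
    by (intro rec_eval.Comp[of _ _ "[form_encode \<phi>]"]) (simp_all add: code s)
  moreover have "satisfiable \<phi> \<longleftrightarrow> rec_eval (Comp r [s]) [m] 0"
    unfolding \<phi>_def \<psi>_def by (rule satisfiable_recf_form)
  ultimately show False
    using rec_eval_deterministic by (metis zero_neq_one)
qed

end
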